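(* Let $A$ be a linear order such that $A^{\omega}$ does not have a parity-reversing automorphism. Then there exists a linear order $X$ such that $A^2X\cong X$ but $AX\not\cong X$.
   Context: Products are lexicographic. $A^\omega$: infinite sequences of elements of $A$ ordered lexicographically; $au$ prepends $a$ to $u$. $u\sim_2 v$ iff there exist finite sequences $r,s$ with $|r|\equiv|s|\pmod 2$ and $u'\in A^\omega$ with $u=ru'$, $v=su'$. A parity-reversing automorphism of $A^\omega$ is an order automorphism $f$ with $f(u)\sim_2 au$ for all $u\in A^\omega$, $a\in A$. *)

theory Defs
  imports Main "HOL-Library.Stream"
begin

text \<open>
  A linear order is a reflexive relation \<open>r\<close> with \<^term>\<open>Linear_order r\<close>; its set of points
  is \<^term>\<open>Field r\<close>, which may be empty.  The library predicate \<^const>\<open>iso\<close> is stated via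
  initial segments; for arbitrary relations it amounts to a bijection of the fields that
  preserves and reflects the relation (see \<open>iso_iff2\<close>).

  Existence of a linear order is stated on a fixed carrier type, since HOL has no quantifier
  over types: for orders obtained from \<open>r :: 'a rel\<close> the type \<open>'a stream \<times> 'a stream set\<close> has room
  for one copy of the successor cardinal of the type of sequences in place of each sequence.
\<close>

definition order_isomorphic :: "'a rel \<Rightarrow> 'b rel \<Rightarrow> bool" (infix "\<cong>\<^sub>o" 50) where
  "r \<cong>\<^sub>o s \<longleftrightarrow> (\<exists>f. iso r s f)"

text \<open>The first coordinate dominates: every point of \<open>r\<close> is replaced by a copy of \<open>s\<close>.\<close>

definition lex_product :: "'a rel \<Rightarrow> 'b rel \<Rightarrow> ('a \<times> 'b) rel" (infixr "\<otimes>\<^sub>l" 70) where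
  "r \<otimes>\<^sub>l s = {((a, x), (b, y)).
     a \<in> Field r \<and> b \<in> Field r \<and> x \<in> Field s \<and> y \<in> Field s \<and>
     ((a, b) \<in> r \<and> a \<noteq> b \<or> a = b \<and> (x, y) \<in> s)}"

definition omega_power :: "'a rel \<Rightarrow> 'a stream rel" where
  "omega_power r = {(u, v).
     u \<in> streams (Field r) \<and> v \<in> streams (Field r) \<and>
     (u = v \<or> (\<exists>n. (\<forall>m<n. u !! m = v !! m) \<and> u !! n \<noteq> v !! n \<and> (u !! n, v !! n) \<in> r))}"

definition sim2 :: "'a set \<Rightarrow> 'a stream \<Rightarrow> 'a stream \<Rightarrow> bool" where
  "sim2 S u v \<longleftrightarrow>
     (\<exists>p\<in>lists S. \<exists>q\<in>lists S. \<exists>w\<in>streams S.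
        length p mod 2 = length q mod 2 \<and> u = p @- w \<and> v = q @- w)"

definition parity_reversing_automorphism :: "'a rel \<Rightarrow> ('a stream \<Rightarrow> 'a stream) \<Rightarrow> bool" where
  "parity_reversing_automorphism r f \<longleftrightarrow>
     iso (omega_power r) (omega_power r) f \<and>
     (\<forall>u\<in>streams (Field r). \<forall>a\<in>Field r. sim2 (Field r) (f u) (a ## u))"

lemma Field_lex_product:
  assumes "Linear_order r" "Linear_order s"
  shows "Field (r \<otimes>\<^sub>l s) = Field r \<times> Field s"
  using assms
  by (fastforce simp: lex_product_def Field_def order_on_defs refl_on_def)

lemma Linear_order_lex_product:
  assumes r: "Linear_order r" and s: "Linear_order s"
  shows "Linear_order (r \<otimes>\<^sub>l s)"
proof -
  have "refl_on (Field r \<times> Field s) (r \<otimes>\<^sub>l s)" "r \<otimes>\<^sub>l s \<subseteq> (Field r \<times> Field s) \<times> (Field r \<times> Field s)"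
    using s by (auto simp: lex_product_def order_on_defs refl_on_def)
  moreover have "antisym (r \<otimes>\<^sub>l s)"
    using r s unfolding lex_product_def order_on_defs antisym_def by auto
  moreover have "trans (r \<otimes>\<^sub>l s)"
  proof -
    have tr: "\<And>x y z. (x, y) \<in> r \<Longrightarrow> (y, z) \<in> r \<Longrightarrow> (x, z) \<in> r"
      and ts: "\<And>x y z. (x, y) \<in> s \<Longrightarrow> (y, z) \<in> s \<Longrightarrow> (x, z) \<in> s"
      and ar: "\<And>x y. (x, y) \<in> r \<Longrightarrow> (y, x) \<in> r \<Longrightarrow> x = y"
      using r s unfolding order_on_defs trans_def antisym_def by blast+
    show ?thesis
    proof (rule transI)
      fix p q t assume "(p, q) \<in> r \<otimes>\<^sub>l s" "(q, t) \<in> r \<otimes>\<^sub>l s"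
      then show "(p, t) \<in> r \<otimes>\<^sub>l s"
        unfolding lex_product_def
        by (cases p; cases q; cases t; simp) (metis tr ts ar)
    qed
  qed
  moreover have "total_on (Field r \<times> Field s) (r \<otimes>\<^sub>l s)"
    using r s unfolding lex_product_def order_on_defs total_on_def by auto
  ultimately show ?thesis
    unfolding Field_lex_product[OF r s] order_on_defs by auto
qed

lemma Field_omega_power: "Field (omega_power r) = streams (Field r)"
  by (auto simp: omega_power_def Field_def)

lemma Linear_order_omega_power:
  assumes r: "Linear_order r"
  shows "Linear_order (omega_power r)"
proof -
  have tr: "trans r" and an: "antisym r" and tot: "total_on (Field r) r"
    using r by (auto simp: order_on_defs)
  have "refl_on (streams (Field r)) (omega_power r)"
    "omega_power r \<subseteq> streams (Field r) \<times> streams (Field r)"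
    by (auto simp: omega_power_def refl_on_def)
  moreover have "antisym (omega_power r)"
  proof (rule antisymI, rule ccontr)
    fix u v assume uv: "(u, v) \<in> omega_power r" "(v, u) \<in> omega_power r" "u \<noteq> v"
    then obtain m n where
      m: "\<forall>i<m. u !! i = v !! i" "u !! m \<noteq> v !! m" "(u !! m, v !! m) \<in> r" and
      n: "\<forall>i<n. v !! i = u !! i" "v !! n \<noteq> u !! n" "(v !! n, u !! n) \<in> r"
      by (auto simp: omega_power_def)
    have "m = n" using m n by (metis linorder_neqE_nat)
    then show False using m n antisymD[OF an] by blast
  qed
  moreover have "trans (omega_power r)"
  proof (rule transI)
    fix u v w assume uv: "(u, v) \<in> omega_power r" and vw: "(v, w) \<in> omega_power r"
    show "(u, w) \<in> omega_power r"
    proof (cases "u = v \<or> v = w")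
      case True then show ?thesis using uv vw by auto
    next
      case False
      then obtain m n where
        m: "\<forall>i<m. u !! i = v !! i" "u !! m \<noteq> v !! m" "(u !! m, v !! m) \<in> r" and
        n: "\<forall>i<n. v !! i = w !! i" "v !! n \<noteq> w !! n" "(v !! n, w !! n) \<in> r"
        using uv vw by (auto simp: omega_power_def)
      define k where "k = min m n"
      have "\<forall>i<k. u !! i = w !! i" using m n by (auto simp: k_def)
      moreover have "u !! k \<noteq> w !! k \<and> (u !! k, w !! k) \<in> r"
      proof (cases m n rule: linorder_cases)
        case less then show ?thesis using m n by (auto simp: k_def min_def)
      next
        case equal then show ?thesis using m n transD[OF tr, of "u !! m" "v !! m" "w !! m"] antisymD[OF an, of "u !! m" "v !! m"]
          by (auto simp: k_def)
      next
        case greater then show ?thesis using m n by (auto simp: k_def min_def)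
      qed
      ultimately show ?thesis using uv vw by (auto simp: omega_power_def)
    qed
  qed
  moreover have "total_on (streams (Field r)) (omega_power r)"
  proof (rule total_onI)
    fix u v assume S: "u \<in> streams (Field r)" "v \<in> streams (Field r)" and "u \<noteq> v"
    then have ex: "\<exists>n. u !! n \<noteq> v !! n"
      by (metis ext smap_alt stream.map_id0 id_apply)
    define n where "n = (LEAST n. u !! n \<noteq> v !! n)"
    have n: "u !! n \<noteq> v !! n" "\<forall>m<n. u !! m = v !! m"
      using LeastI_ex[OF ex] not_less_Least[of _ "\<lambda>n. u !! n \<noteq> v !! n"] unfolding n_def by blast+
    have "u !! n \<in> Field r" "v !! n \<in> Field r"
      using S by (auto simp: streams_iff_snth)
    then have "(u !! n, v !! n) \<in> r \<or> (v !! n, u !! n) \<in> r"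
      using tot n by (auto simp: total_on_def)
    then show "(u, v) \<in> omega_power r \<or> (v, u) \<in> omega_power r"
    proof
      assume "(u !! n, v !! n) \<in> r"
      then have "(u, v) \<in> omega_power r" using S n unfolding omega_power_def by blast
      then show ?thesis ..
    next
      assume "(v !! n, u !! n) \<in> r"
      then have "(v, u) \<in> omega_power r"
        using S n(1)[symmetric] n(2)[THEN spec, THEN mp, THEN sym] unfolding omega_power_def by blast
      then show ?thesis ..
    qed
  qed
  ultimately show ?thesis
    unfolding Field_omega_power order_on_defs by auto
qed

end

theory Submission
  imports Defs "HOL-Library.FuncSet"
begin

text \<open>
  Let \<open>I\<close> assign to every \<open>\<sim>\<^sub>2\<close>-class of sequences an order \<open>I\<^sub>C\<close> of the form \<open>\<omega>\<^sup>* + \<alpha>\<^sub>C\<close>, the ordinals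
  \<open>\<alpha>\<^sub>C\<close> being distinct limits, and let \<open>X\<close> be \<open>A\<^sup>\<omega>\<close> with each sequence \<open>u\<close> replaced by a copy of \<open>I\<^bsub>[u]\<^esub>\<close>.
  Prepending two letters does not change the class, so \<open>A\<^sup>2X \<cong> X\<close>, whereas \<open>AX\<close> is
  \<open>A\<^sup>\<omega>\<close> with each \<open>au\<close> replaced by \<open>I\<^bsub>[u]\<^esub>\<close>.  In \<open>I\<^sub>C\<close> there is no least element, but every nonempty
  subset that is bounded below has one; hence an isomorphic image of \<open>I\<^sub>C\<close> cannot be
  spread over several copies, and an isomorphism \<open>AX \<cong> X\<close> permutes the copies.  It thus induces an
  automorphism \<open>f\<close> of \<open>A\<^sup>\<omega>\<close> with \<open>I\<^bsub>[u]\<^esub> \<cong> I\<^bsub>[f(au)]\<^esub>\<close>, that is, \<open>f(au) \<sim>\<^sub>2 u \<sim>\<^sub>2 bau\<close>: it is parity-reversing.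
\<close>

section \<open>Isomorphisms\<close>

lemma iso_inv_into:
  assumes "iso r s f"
  shows "iso s r (inv_into (Field r) f)"
proof -
  have b: "bij_betw f (Field r) (Field s)"
    and m: "\<And>a b. a \<in> Field r \<Longrightarrow> b \<in> Field r \<Longrightarrow> (a, b) \<in> r \<longleftrightarrow> (f a, f b) \<in> s"
    using assms by (auto simp: iso_iff2)
  have "inv_into (Field r) f y \<in> Field r \<and> f (inv_into (Field r) f y) = y" if "y \<in> Field s" for y
    using that b by (metis bij_betw_def f_inv_into_f inv_into_into)
  with m bij_betw_inv_into[OF b] show ?thesis
    by (simp add: iso_iff2)
qed

lemma iso_compose:
  assumes "iso r s f" "iso s t g"
  shows "iso r t (g \<circ> f)"
proof -
  have "\<And>a. a \<in> Field r \<Longrightarrow> f a \<in> Field s"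
    using assms(1) by (auto simp: iso_iff2 bij_betw_def)
  then show ?thesis
    using assms bij_betw_trans by (auto simp: iso_iff2)
qed

lemma order_isomorphic_sym: "r \<cong>\<^sub>o s \<Longrightarrow> s \<cong>\<^sub>o r"
  by (auto simp: order_isomorphic_def dest: iso_inv_into)

lemma order_isomorphic_trans [trans]: "r \<cong>\<^sub>o s \<Longrightarrow> s \<cong>\<^sub>o t \<Longrightarrow> r \<cong>\<^sub>o t"
  by (auto simp: order_isomorphic_def dest: iso_compose)

lemma iso_dir_image:
  assumes "inj_on f (Field r)"
  shows "iso r (dir_image r f) f"
  unfolding iso_iff2
proof (intro conjI ballI)
  show "bij_betw f (Field r) (Field (dir_image r f))"
    using assms by (simp add: dir_image_Field bij_betw_def)
  show "(a, b) \<in> r \<longleftrightarrow> (f a, f b) \<in> dir_image r f" if "a \<in> Field r" "b \<in> Field r" for a b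
  proof
    assume "(f a, f b) \<in> dir_image r f"
    then obtain a' b' where ab: "f a = f a'" "f b = f b'" "(a', b') \<in> r"
      by (auto simp: dir_image_def)
    moreover have "a' \<in> Field r" "b' \<in> Field r"
      using ab(3) by (auto simp: Field_def)
    ultimately show "(a, b) \<in> r"
      using that assms by (metis inj_onD)
  qed (auto simp: dir_image_def)
qed

section \<open>Sums over a linear order\<close>

text \<open>Generalises \<open>lex_product\<close>: the order put in place of a point may depend on
  the point, and constant \<open>I\<close> gives back the product.\<close>

definition lex_sum :: "'a rel \<Rightarrow> ('a \<Rightarrow> 'b rel) \<Rightarrow> ('a \<times> 'b) rel" where
  "lex_sum r I = {((a, x), (b, y)).
     a \<in> Field r \<and> b \<in> Field r \<and> x \<in> Field (I a) \<and> y \<in> Field (I b) \<and>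
     ((a, b) \<in> r \<and> a \<noteq> b \<or> a = b \<and> (x, y) \<in> I a)}"

lemma lex_sum_iff:
  "((a, x), (b, y)) \<in> lex_sum r I \<longleftrightarrow>
     a \<in> Field r \<and> b \<in> Field r \<and> x \<in> Field (I a) \<and> y \<in> Field (I b) \<and>
     ((a, b) \<in> r \<and> a \<noteq> b \<or> a = b \<and> (x, y) \<in> I a)"
  by (simp add: lex_sum_def)

lemma lex_product_iff:
  "((a, x), (b, y)) \<in> r \<otimes>\<^sub>l s \<longleftrightarrow>
     a \<in> Field r \<and> b \<in> Field r \<and> x \<in> Field s \<and> y \<in> Field s \<and>
     ((a, b) \<in> r \<and> a \<noteq> b \<or> a = b \<and> (x, y) \<in> s)"
  by (simp add: lex_product_def)

lemma Linear_orderD: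
  assumes "Linear_order r"
  shows "\<And>x. x \<in> Field r \<Longrightarrow> (x, x) \<in> r"
    and "\<And>x y z. (x, y) \<in> r \<Longrightarrow> (y, z) \<in> r \<Longrightarrow> (x, z) \<in> r"
    and "\<And>x y. (x, y) \<in> r \<Longrightarrow> (y, x) \<in> r \<Longrightarrow> x = y"
    and "\<And>x y. x \<in> Field r \<Longrightarrow> y \<in> Field r \<Longrightarrow> (x, y) \<in> r \<or> (y, x) \<in> r"
  using assms unfolding order_on_defs
  by (auto simp: refl_on_def total_on_def dest: transD antisymD) metis

lemma Field_lex_sum:
  assumes "\<And>a. a \<in> Field r \<Longrightarrow> Linear_order (I a)"
  shows "Field (lex_sum r I) = Sigma (Field r) (\<lambda>a. Field (I a))"
proof
  show "Field (lex_sum r I) \<subseteq> Sigma (Field r) (\<lambda>a. Field (I a))"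
    by (auto simp: Field_def[of "lex_sum r I"] lex_sum_iff)
  show "Sigma (Field r) (\<lambda>a. Field (I a)) \<subseteq> Field (lex_sum r I)"
  proof clarify
    fix a x assume "a \<in> Field r" "x \<in> Field (I a)"
    then have "((a, x), (a, x)) \<in> lex_sum r I"
      using Linear_orderD(1)[OF assms] by (simp add: lex_sum_iff)
    then show "(a, x) \<in> Field (lex_sum r I)"
      by (rule FieldI1)
  qed
qed

lemma Linear_order_lex_sum:
  assumes r: "Linear_order r" and I: "\<And>a. a \<in> Field r \<Longrightarrow> Linear_order (I a)"
  shows "Linear_order (lex_sum r I)"
proof -
  have F: "Field (lex_sum r I) = Sigma (Field r) (\<lambda>a. Field (I a))"
    using I by (rule Field_lex_sum)
  note R = Linear_orderD[OF r] and J = Linear_orderD[OF I]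
  have "Refl (lex_sum r I)"
    unfolding refl_on_def F using J(1) by (auto simp: lex_sum_iff)
  moreover have "lex_sum r I \<subseteq> Field (lex_sum r I) \<times> Field (lex_sum r I)"
    by (auto intro: FieldI1 FieldI2)
  moreover have "antisym (lex_sum r I)"
  proof (rule antisymI)
    fix p q assume "(p, q) \<in> lex_sum r I" "(q, p) \<in> lex_sum r I"
    then show "p = q"
      by (cases p; cases q; simp add: lex_sum_iff) (metis R(3) J(3))
  qed
  moreover have "trans (lex_sum r I)"
  proof (rule transI)
    fix p q t assume "(p, q) \<in> lex_sum r I" "(q, t) \<in> lex_sum r I"
    then show "(p, t) \<in> lex_sum r I"
      by (cases p; cases q; cases t; simp add: lex_sum_iff) (metis R(2,3) J(2))
  qed
  moreover have "Total (lex_sum r I)"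
    unfolding total_on_def F
  proof clarify
    fix a x b y
    assume "a \<in> Field r" "b \<in> Field r" "x \<in> Field (I a)" "y \<in> Field (I b)"
      and "((b, y), (a, x)) \<notin> lex_sum r I"
    then show "((a, x), (b, y)) \<in> lex_sum r I"
      using R(4)[of a b] J(4)[of a x y] by (auto simp: lex_sum_iff)
  qed
  ultimately show ?thesis
    by (simp add: order_on_defs)
qed

section \<open>Lexicographic products up to isomorphism\<close>

lemma order_isomorphic_lex_product_right:
  assumes "Linear_order s" "Linear_order t" "Linear_order r" "s \<cong>\<^sub>o t"
  shows "r \<otimes>\<^sub>l s \<cong>\<^sub>o r \<otimes>\<^sub>l t"
proof -
  obtain f where f: "bij_betw f (Field s) (Field t)"
    "\<And>a b. a \<in> Field s \<Longrightarrow> b \<in> Field s \<Longrightarrow> (a, b) \<in> s \<longleftrightarrow> (f a, f b) \<in> t"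
    using assms(4) by (auto simp: order_isomorphic_def iso_iff2)
  have "bij_betw (map_prod id f) (Field r \<times> Field s) (Field r \<times> Field t)"
    using f(1) by (intro bij_betw_map_prod) auto
  moreover have "\<And>a. a \<in> Field s \<Longrightarrow> f a \<in> Field t"
    using f(1) by (auto simp: bij_betw_def)
  ultimately have "iso (r \<otimes>\<^sub>l s) (r \<otimes>\<^sub>l t) (map_prod id f)"
    using assms f(2) by (simp add: iso_iff2 Field_lex_product lex_product_iff)
  then show ?thesis
    by (auto simp: order_isomorphic_def)
qed

lemma order_isomorphic_lex_product_assoc:
  assumes "Linear_order r" "Linear_order s" "Linear_order t"
  shows "(r \<otimes>\<^sub>l s) \<otimes>\<^sub>l t \<cong>\<^sub>o r \<otimes>\<^sub>l (s \<otimes>\<^sub>l t)"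
proof -
  have "bij_betw (\<lambda>((a, b), c). (a, b, c))
      ((Field r \<times> Field s) \<times> Field t) (Field r \<times> Field s \<times> Field t)"
    by (rule bij_betwI[where g = "\<lambda>(a, b, c). ((a, b), c)"]) auto
  moreover have "Field ((r \<otimes>\<^sub>l s) \<otimes>\<^sub>l t) = (Field r \<times> Field s) \<times> Field t"
    "Field (r \<otimes>\<^sub>l (s \<otimes>\<^sub>l t)) = Field r \<times> Field s \<times> Field t"
    using assms by (metis Field_lex_product Linear_order_lex_product)+
  ultimately have "iso ((r \<otimes>\<^sub>l s) \<otimes>\<^sub>l t) (r \<otimes>\<^sub>l (s \<otimes>\<^sub>l t)) (\<lambda>((a, b), c). (a, b, c))"
    using assms by (auto simp: iso_iff2 lex_product_iff Field_lex_product)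
  then show ?thesis
    by (auto simp: order_isomorphic_def)
qed

section \<open>Isomorphisms of sums that map fibres to fibres\<close>

definition fibre_preserving :: "('a \<times> 'b) set \<Rightarrow> ('a \<times> 'b \<Rightarrow> 'c \<times> 'd) \<Rightarrow> bool" where
  "fibre_preserving S f \<longleftrightarrow>
     (\<forall>a x y. (a, x) \<in> S \<longrightarrow> (a, y) \<in> S \<longrightarrow> fst (f (a, x)) = fst (f (a, y)))"

text \<open>\<open>F\<close> and its inverse both carry each fibre into a single fibre, so they
  induce maps of the index orders that undo each other; nonempty fibres let every index be reached.
  \<open>F\<close> then restricts to a bijection from the fibre over \<open>a\<close> onto the whole
  fibre over \<open>g a\<close>.\<close>

lemma fibre_preserving_iso_induces_iso:
  assumes r: "Linear_order r" and q: "Linear_order q"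
    and I: "\<And>a. a \<in> Field r \<Longrightarrow> Linear_order (I a)" "\<And>a. a \<in> Field r \<Longrightarrow> Field (I a) \<noteq> {}"
    and J: "\<And>a. a \<in> Field q \<Longrightarrow> Linear_order (J a)" "\<And>a. a \<in> Field q \<Longrightarrow> Field (J a) \<noteq> {}"
    and F: "iso (lex_sum r I) (lex_sum q J) F"
    and pF: "fibre_preserving (Field (lex_sum r I)) F"
    and pG: "fibre_preserving (Field (lex_sum q J)) (inv_into (Field (lex_sum r I)) F)"
  shows "\<exists>g. iso r q g \<and> (\<forall>a\<in>Field r. I a \<cong>\<^sub>o J (g a))"
proof -
  define G where "G = inv_into (Field (lex_sum r I)) F"
  have FI: "Field (lex_sum r I) = Sigma (Field r) (\<lambda>a. Field (I a))"
    using I(1) by (rule Field_lex_sum)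
  have FJ: "Field (lex_sum q J) = Sigma (Field q) (\<lambda>a. Field (J a))"
    using J(1) by (rule Field_lex_sum)
  have bF: "bij_betw F (Field (lex_sum r I)) (Field (lex_sum q J))"
    and mF: "\<And>s t. s \<in> Field (lex_sum r I) \<Longrightarrow> t \<in> Field (lex_sum r I) \<Longrightarrow>
      (s, t) \<in> lex_sum r I \<longleftrightarrow> (F s, F t) \<in> lex_sum q J"
    using F by (auto simp: iso_iff2)
  have GF: "\<And>s. s \<in> Field (lex_sum r I) \<Longrightarrow> G (F s) = s"
    using bF by (auto simp: G_def bij_betw_def)
  have FG: "\<And>t. t \<in> Field (lex_sum q J) \<Longrightarrow> F (G t) = t"
    unfolding G_def using bF by (metis bij_betw_inv_into_right)
  have Fin: "\<And>s. s \<in> Field (lex_sum r I) \<Longrightarrow> F s \<in> Field (lex_sum q J)"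
    using bF by (auto simp: bij_betw_def)
  have Gin: "\<And>t. t \<in> Field (lex_sum q J) \<Longrightarrow> G t \<in> Field (lex_sum r I)"
    unfolding G_def using bF by (metis bij_betw_def inv_into_into)
  \<comment> \<open>By fibre preservation the chosen point of the fibre does not affect the
    resulting index.\<close>
  define g where "g a = fst (F (a, SOME x. x \<in> Field (I a)))" for a
  define h where "h b = fst (G (b, SOME y. y \<in> Field (J b)))" for b
  have g: "fst (F (a, x)) = g a" if "a \<in> Field r" "x \<in> Field (I a)" for a x
  proof -
    have "(SOME x. x \<in> Field (I a)) \<in> Field (I a)"
      using that(2) by (rule someI)
    then show ?thesis
      using pF that unfolding fibre_preserving_def g_def FI by blast
  qed
  have h: "fst (G (b, y)) = h b" if "b \<in> Field q" "y \<in> Field (J b)" for b y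
  proof -
    have "(SOME y. y \<in> Field (J b)) \<in> Field (J b)"
      using that(2) by (rule someI)
    then show ?thesis
      using pG that unfolding fibre_preserving_def h_def FJ G_def by blast
  qed
  have F_eq: "F (a, x) = (g a, snd (F (a, x)))" "g a \<in> Field q" "snd (F (a, x)) \<in> Field (J (g a))"
    if "a \<in> Field r" "x \<in> Field (I a)" for a x
    using g[OF that] Fin[of "(a, x)"] that unfolding FI FJ by (auto simp: prod_eq_iff)
  have G_eq: "G (b, y) = (h b, snd (G (b, y)))" "h b \<in> Field r" "snd (G (b, y)) \<in> Field (I (h b))"
    if "b \<in> Field q" "y \<in> Field (J b)" for b y
    using h[OF that] Gin[of "(b, y)"] that unfolding FI FJ by (auto simp: prod_eq_iff)
  have hg: "h (g a) = a" if a: "a \<in> Field r" for a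
  proof -
    obtain x where x: "x \<in> Field (I a)"
      using I(2)[OF a] by blast
    have "G (F (a, x)) = (a, x)"
      using a x by (intro GF) (simp add: FI)
    then show ?thesis
      using F_eq[OF a x] h[of "g a" "snd (F (a, x))"] by simp
  qed
  have gh: "g (h b) = b" if b: "b \<in> Field q" for b
  proof -
    obtain y where y: "y \<in> Field (J b)"
      using J(2)[OF b] by blast
    have "F (G (b, y)) = (b, y)"
      using b y by (intro FG) (simp add: FJ)
    then show ?thesis
      using G_eq[OF b y] g[of "h b" "snd (G (b, y))"] by simp
  qed
  have gin: "g a \<in> Field q" if "a \<in> Field r" for a
    using I(2)[OF that] F_eq(2)[OF that] by blast
  have hin: "h b \<in> Field r" if "b \<in> Field q" for b
    using J(2)[OF that] G_eq(2)[OF that] by blast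
  have mono: "(g a, g b) \<in> q" if ab: "(a, b) \<in> r" for a b
  proof (cases "a = b")
    case True
    then show ?thesis
      using ab gin Linear_orderD(1)[OF q] by (metis FieldI1)
  next
    case False
    have a: "a \<in> Field r" and b: "b \<in> Field r"
      using ab by (auto intro: FieldI1 FieldI2)
    obtain x y where x: "x \<in> Field (I a)" and y: "y \<in> Field (I b)"
      using I(2)[OF a] I(2)[OF b] by blast
    have "(F (a, x), F (b, y)) \<in> lex_sum q J"
      using mF[of "(a, x)" "(b, y)"] a b x y ab False by (simp add: FI lex_sum_iff)
    \<comment> \<open>Since \<open>h\<close> undoes \<open>g\<close>, the two images lie in
      different fibres and are compared by their first coordinates.\<close>
    moreover have "g a \<noteq> g b"
      using hg a b False by metis
    ultimately have "((g a, snd (F (a, x))), (g b, snd (F (b, y)))) \<in> lex_sum q J" "g a \<noteq> g b"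
      using F_eq(1)[OF a x] F_eq(1)[OF b y] by simp_all
    then show ?thesis
      by (simp add: lex_sum_iff)
  qed
  have "iso r q g"
    unfolding iso_iff2
  proof (intro conjI ballI)
    show "bij_betw g (Field r) (Field q)"
      using gin hin hg gh by (intro bij_betwI[where g = h]) auto
    \<comment> \<open>Reflection uses totality: if \<open>(a, b)\<close> is not in \<open>r\<close>,
      then \<open>(g b, g a)\<close> is in \<open>q\<close>, and antisymmetry together with
      \<open>h\<close> gives \<open>a = b\<close>.\<close>
    show "(a, b) \<in> r \<longleftrightarrow> (g a, g b) \<in> q" if "a \<in> Field r" "b \<in> Field r" for a b
      using that mono hg Linear_orderD(1,4)[OF r] Linear_orderD(3)[OF q] by metis
  qed
  moreover have "I a \<cong>\<^sub>o J (g a)" if a: "a \<in> Field r" for a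
  proof -
    define k where "k x = snd (F (a, x))" for x
    have Fk: "F (a, x) = (g a, k x)" "k x \<in> Field (J (g a))" if "x \<in> Field (I a)" for x
      using F_eq[OF a that] by (auto simp: k_def)
    have "bij_betw k (Field (I a)) (Field (J (g a)))"
    proof (rule bij_betwI[where g = "\<lambda>y. snd (G (g a, y))"])
      show "k \<in> Field (I a) \<rightarrow> Field (J (g a))"
        using Fk by auto
      show "(\<lambda>y. snd (G (g a, y))) \<in> Field (J (g a)) \<rightarrow> Field (I a)"
        using G_eq(3)[OF gin[OF a]] hg[OF a] by auto
      show "snd (G (g a, k x)) = x" if "x \<in> Field (I a)" for x
        using Fk[OF that] GF[of "(a, x)"] a that by (simp add: FI)
      show "k (snd (G (g a, y))) = y" if y: "y \<in> Field (J (g a))" for y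
        using G_eq[OF gin[OF a] y] FG[of "(g a, y)"] gin[OF a] y hg[OF a]
        by (simp add: FJ k_def)
    qed
    moreover have "(x, y) \<in> I a \<longleftrightarrow> (k x, k y) \<in> J (g a)"
      if "x \<in> Field (I a)" "y \<in> Field (I a)" for x y
      using mF[of "(a, x)" "(a, y)"] Fk that a gin[OF a] by (simp add: FI lex_sum_iff)
    ultimately show ?thesis
      by (auto simp: order_isomorphic_def iso_iff2)
  qed
  ultimately show ?thesis
    by blast
qed

section \<open>Orders without least element whose final segments are well-ordered\<close>

text \<open>These properties hold of every order \<open>\<omega>\<^sup>* + \<alpha>\<close> with
  \<open>\<alpha>\<close> an ordinal; they are stated without ordinals so that fibres can be handled
  through them alone.\<close>

definition bottomless_wo :: "'a rel \<Rightarrow> bool" where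
  "bottomless_wo s \<longleftrightarrow>
     Linear_order s \<and> Field s \<noteq> {} \<and> (\<forall>x\<in>Field s. \<exists>y. (y, x) \<in> s \<and> y \<noteq> x) \<and>
     (\<forall>R b. R \<subseteq> Field s \<longrightarrow> R \<noteq> {} \<longrightarrow> (\<forall>y\<in>R. (b, y) \<in> s) \<longrightarrow> (\<exists>m\<in>R. \<forall>y\<in>R. (m, y) \<in> s))"

lemma bottomless_woD:
  assumes "bottomless_wo s"
  shows "Linear_order s" "Field s \<noteq> {}"
    and "\<And>x. x \<in> Field s \<Longrightarrow> \<exists>y. (y, x) \<in> s \<and> y \<noteq> x"
    and "\<And>R b. R \<subseteq> Field s \<Longrightarrow> R \<noteq> {} \<Longrightarrow> (\<And>y. y \<in> R \<Longrightarrow> (b, y) \<in> s) \<Longrightarrow>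
      \<exists>m\<in>R. \<forall>y\<in>R. (m, y) \<in> s"
  using assms unfolding bottomless_wo_def by simp_all metis

text \<open>Pulling a set back along \<open>f\<close> also pulls back its lower bound, which lies in
  the field because the set is nonempty. This lets the orders be moved to another carrier
  type.\<close>

lemma bottomless_wo_iso:
  assumes f: "iso r s f" and s: "Linear_order s" and r: "bottomless_wo r"
  shows "bottomless_wo s"
  unfolding bottomless_wo_def
proof (intro conjI ballI allI impI)
  have im: "f ` Field r = Field s"
    and m: "\<And>a b. a \<in> Field r \<Longrightarrow> b \<in> Field r \<Longrightarrow> (a, b) \<in> r \<longleftrightarrow> (f a, f b) \<in> s"
    and inj: "inj_on f (Field r)"
    using f by (auto simp: iso_iff2 bij_betw_def)
  show "Linear_order s"
    by (rule s)
  show "Field s \<noteq> {}"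
    using bottomless_woD(2)[OF r] im by auto
  show "\<exists>y. (y, x) \<in> s \<and> y \<noteq> x" if "x \<in> Field s" for x
  proof -
    obtain a where a: "a \<in> Field r" "x = f a"
      using \<open>x \<in> Field s\<close> im by auto
    obtain b where b: "(b, a) \<in> r" "b \<noteq> a"
      using bottomless_woD(3)[OF r a(1)] by auto
    then have "b \<in> Field r"
      by (auto intro: FieldI1)
    then have "(f b, f a) \<in> s" "f b \<noteq> f a"
      using a b m inj by (auto dest: inj_onD)
    then show ?thesis
      using a by auto
  qed
  show "\<exists>m\<in>R. \<forall>y\<in>R. (m, y) \<in> s"
    if R: "R \<subseteq> Field s" "R \<noteq> {}" and b: "\<forall>y\<in>R. (b, y) \<in> s" for R b
  proof -
    define Q where "Q = {a \<in> Field r. f a \<in> R}"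
    have RQ: "R = f ` Q"
      using R(1) im by (auto simp: Q_def)
    have "b \<in> Field s"
      using R(2) b by (auto intro: FieldI1)
    then obtain a where a: "a \<in> Field r" "b = f a"
      using im by auto
    have "\<exists>m\<in>Q. \<forall>y\<in>Q. (m, y) \<in> r"
    proof (rule bottomless_woD(4)[OF r, of Q a])
      show "Q \<subseteq> Field r"
        by (auto simp: Q_def)
      show "Q \<noteq> {}"
        using R(2) unfolding RQ by simp
      show "(a, y) \<in> r" if "y \<in> Q" for y
        using that a b m by (auto simp: Q_def)
    qed
    then obtain m0 where m0: "m0 \<in> Q" "\<And>y. y \<in> Q \<Longrightarrow> (m0, y) \<in> r"
      by auto
    have "(f m0, f y) \<in> s" if "y \<in> Q" for y
      using m[of m0 y] m0 that by (simp add: Q_def)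
    then show ?thesis
      unfolding RQ using m0(1) by (simp only: ball_simps bex_simps) blast
  qed
qed

text \<open>
  The part of \<open>I a\<close> sent beyond the fibre of the image of \<open>x\<close> is bounded below by \<open>x\<close>.  Its
  least element would be sent to the least element of a fibre.
\<close>

lemma bottomless_wo_fibre_preserving:
  assumes r: "Linear_order r" and q: "Linear_order q"
    and I: "\<And>a. a \<in> Field r \<Longrightarrow> bottomless_wo (I a)"
    and J: "\<And>a. a \<in> Field q \<Longrightarrow> bottomless_wo (J a)"
    and F: "iso (lex_sum r I) (lex_sum q J) F"
  shows "fibre_preserving (Field (lex_sum r I)) F"
proof -
  have FI: "Field (lex_sum r I) = Sigma (Field r) (\<lambda>a. Field (I a))"
    using I by (intro Field_lex_sum bottomless_woD(1))
  have FJ: "Field (lex_sum q J) = Sigma (Field q) (\<lambda>a. Field (J a))"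
    using J by (intro Field_lex_sum bottomless_woD(1))
  have im: "F ` Field (lex_sum r I) = Field (lex_sum q J)"
    and mF: "\<And>s t. s \<in> Field (lex_sum r I) \<Longrightarrow> t \<in> Field (lex_sum r I) \<Longrightarrow>
      (s, t) \<in> lex_sum r I \<longleftrightarrow> (F s, F t) \<in> lex_sum q J"
    using F by (auto simp: iso_iff2 bij_betw_def)
  have mono: "(fst (F (a, x)), fst (F (a, y))) \<in> q"
    if "a \<in> Field r" "(x, y) \<in> I a" for a x y
  proof -
    have xy: "x \<in> Field (I a)" "y \<in> Field (I a)"
      using that(2) by (auto intro: FieldI1 FieldI2)
    then have "(F (a, x), F (a, y)) \<in> lex_sum q J"
      using mF[of "(a, x)" "(a, y)"] that by (simp add: FI lex_sum_iff)
    then show ?thesis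
      using Linear_orderD(1)[OF q]
      by (cases "F (a, x)"; cases "F (a, y)") (auto simp: lex_sum_iff)
  qed
  have main: "fst (F (a, x)) = fst (F (a, y))" if a: "a \<in> Field r" and xy: "(x, y) \<in> I a" for a x y
  proof (rule ccontr)
    assume ne: "fst (F (a, x)) \<noteq> fst (F (a, y))"
    have fld: "x \<in> Field (I a)" "y \<in> Field (I a)"
      using xy by (auto intro: FieldI1 FieldI2)
    define v where "v = fst (F (a, x))"
    define R where "R = {z \<in> Field (I a). (fst (F (a, z)), v) \<notin> q}"
    have "\<exists>m\<in>R. \<forall>z\<in>R. (m, z) \<in> I a"
    proof (rule bottomless_woD(4)[OF I[OF a], of R x])
      show "R \<subseteq> Field (I a)"
        by (auto simp: R_def)
      have "y \<in> R"
        using fld ne mono[OF a xy] Linear_orderD(3)[OF q] by (auto simp: R_def v_def)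
      then show "R \<noteq> {}"
        by auto
      show "(x, z) \<in> I a" if "z \<in> R" for z
        using that fld mono[OF a, of z x] Linear_orderD(4)[OF bottomless_woD(1)[OF I[OF a]], of x z]
        by (auto simp: R_def v_def)
    qed
    then obtain m where m: "m \<in> R" "\<And>z. z \<in> R \<Longrightarrow> (m, z) \<in> I a"
      by auto
    obtain w k where wk: "F (a, m) = (w, k)"
      by fastforce
    have mI: "m \<in> Field (I a)" and wv: "(w, v) \<notin> q"
      using m(1) wk by (auto simp: R_def)
    have wk_in: "w \<in> Field q" "k \<in> Field (J w)"
      using im wk a mI unfolding FI FJ by force+
    \<comment> \<open>The fibre over \<open>w\<close> has no least element, so some point of it lies
      strictly below the image of \<open>m\<close>. Its preimage is trapped between
      \<open>(a, x)\<close> and \<open>(a, m)\<close>, hence lies in the fibre over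
      \<open>a\<close>, and contradicts the choice of \<open>m\<close>.\<close>
    obtain l where l: "(l, k) \<in> J w" "l \<noteq> k"
      using bottomless_woD(3)[OF J[OF wk_in(1)] wk_in(2)] by auto
    have lJ: "l \<in> Field (J w)"
      using l(1) by (rule FieldI1)
    then have "(w, l) \<in> F ` Field (lex_sum r I)"
      using wk_in unfolding im FJ by simp
    then obtain b z where bz: "b \<in> Field r" "z \<in> Field (I b)" "F (b, z) = (w, l)"
      unfolding FI by auto
    have "F (a, x) \<in> Field (lex_sum q J)"
      using a fld unfolding im[symmetric] FI by blast
    then obtain j where vx: "F (a, x) = (v, j)" "v \<in> Field q" "j \<in> Field (J v)"
      unfolding FJ v_def by auto
    have vw: "(v, w) \<in> q" "v \<noteq> w"
      using wv vx(2) wk_in(1) Linear_orderD(1,4)[OF q] by auto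
    have "(F (a, x), F (b, z)) \<in> lex_sum q J"
      unfolding vx(1) bz(3) using vx(2,3) vw wk_in lJ by (simp add: lex_sum_iff)
    then have "((a, x), (b, z)) \<in> lex_sum r I"
      using mF[of "(a, x)" "(b, z)"] a fld bz by (simp add: FI)
    moreover have zm: "((b, z), (a, m)) \<in> lex_sum r I"
      using mF[of "(b, z)" "(a, m)"] wk bz a mI wk_in l lJ by (simp add: FI lex_sum_iff)
    ultimately have "b = a"
      using Linear_orderD(3)[OF r] by (auto simp: lex_sum_iff)
    then have "z \<in> R"
      using bz wv by (simp add: R_def)
    then have "((a, m), (b, z)) \<in> lex_sum r I"
      using m(2)[of z] a mI bz \<open>b = a\<close> by (simp add: lex_sum_iff)
    then have "((w, k), (w, l)) \<in> lex_sum q J"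
      using mF[of "(a, m)" "(b, z)"] wk bz a mI by (simp add: FI)
    then show False
      using l Linear_orderD(3)[OF bottomless_woD(1)[OF J[OF wk_in(1)]]] by (auto simp: lex_sum_iff)
  qed
  show ?thesis
    unfolding fibre_preserving_def FI
  proof (intro allI impI)
    fix a x y
    assume "(a, x) \<in> (SIGMA a:Field r. Field (I a))" "(a, y) \<in> (SIGMA a:Field r. Field (I a))"
    then have a: "a \<in> Field r" and "x \<in> Field (I a)" "y \<in> Field (I a)"
      by auto
    then have "(x, y) \<in> I a \<or> (y, x) \<in> I a"
      by (intro Linear_orderD(4)[OF bottomless_woD(1)[OF I]])
    then show "fst (F (a, x)) = fst (F (a, y))"
      using main[OF a, of x y] main[OF a, of y x] by auto
  qed
qed

text \<open>The hypotheses on \<open>I\<close> and \<open>J\<close> are the same, so fibre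
  preservation applies to \<open>F\<close> and to its inverse alike.\<close>

lemma bottomless_wo_sum_iso:
  assumes r: "Linear_order r" and q: "Linear_order q"
    and I: "\<And>a. a \<in> Field r \<Longrightarrow> bottomless_wo (I a)"
    and J: "\<And>a. a \<in> Field q \<Longrightarrow> bottomless_wo (J a)"
    and F: "iso (lex_sum r I) (lex_sum q J) F"
  shows "\<exists>g. iso r q g \<and> (\<forall>a\<in>Field r. I a \<cong>\<^sub>o J (g a))"
  using r q
proof (rule fibre_preserving_iso_induces_iso[OF _ _ _ _ _ _ F])
  show "fibre_preserving (Field (lex_sum r I)) F"
    using r q I J F by (rule bottomless_wo_fibre_preserving)
  show "fibre_preserving (Field (lex_sum q J)) (inv_into (Field (lex_sum r I)) F)"
    using q r J I iso_inv_into[OF F] by (rule bottomless_wo_fibre_preserving)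
qed (simp_all add: I J bottomless_woD(1,2))

section \<open>Many non-isomorphic orders\<close>

text \<open>If the images of one fibre met two fibres, an infinite final segment of the lower one
  would lie between two images, and its preimage would have to fit into a finite interval.\<close>

lemma locally_finite_fibre_preserving:
  assumes r: "Linear_order r" and q: "Linear_order q"
    and I: "\<And>a. a \<in> Field r \<Longrightarrow> Linear_order (I a)"
    and J: "\<And>a. a \<in> Field q \<Longrightarrow> Linear_order (J a)"
    and fin: "\<And>a x y. a \<in> Field r \<Longrightarrow> finite {z. (x, z) \<in> I a \<and> (z, y) \<in> I a}"
    and inf: "\<And>a x. a \<in> Field q \<Longrightarrow> x \<in> Field (J a) \<Longrightarrow> infinite {z. (x, z) \<in> J a}"
    and F: "iso (lex_sum r I) (lex_sum q J) F"
  shows "fibre_preserving (Field (lex_sum r I)) F"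
proof -
  have FI: "Field (lex_sum r I) = Sigma (Field r) (\<lambda>a. Field (I a))"
    using I by (rule Field_lex_sum)
  have FJ: "Field (lex_sum q J) = Sigma (Field q) (\<lambda>a. Field (J a))"
    using J by (rule Field_lex_sum)
  have im: "F ` Field (lex_sum r I) = Field (lex_sum q J)"
    and mF: "\<And>s t. s \<in> Field (lex_sum r I) \<Longrightarrow> t \<in> Field (lex_sum r I) \<Longrightarrow>
      (s, t) \<in> lex_sum r I \<longleftrightarrow> (F s, F t) \<in> lex_sum q J"
    using F by (auto simp: iso_iff2 bij_betw_def)
  have main: "fst (F (a, x)) = fst (F (a, y))" if a: "a \<in> Field r" and xy: "(x, y) \<in> I a" for a x y
  proof (rule ccontr)
    assume ne: "fst (F (a, x)) \<noteq> fst (F (a, y))"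
    have fld: "x \<in> Field (I a)" "y \<in> Field (I a)"
      using xy by (auto intro: FieldI1 FieldI2)
    obtain v j w k where vj: "F (a, x) = (v, j)" and wk: "F (a, y) = (w, k)"
      by fastforce
    have "((v, j), (w, k)) \<in> lex_sum q J"
      using mF[of "(a, x)" "(a, y)"] fld a xy vj wk by (simp add: FI lex_sum_iff)
    then have vw: "(v, w) \<in> q" "v \<noteq> w" "v \<in> Field q" "w \<in> Field q"
      "j \<in> Field (J v)" "k \<in> Field (J w)"
      using ne vj wk by (auto simp: lex_sum_iff)
    \<comment> \<open>Everything from \<open>j\<close> upwards in the fibre over \<open>v\<close>
      stays below the fibre over \<open>w\<close>, so its preimages lie between \<open>x\<close> and
      \<open>y\<close>.\<close>
    have "Pair v ` {z. (j, z) \<in> J v} \<subseteq> F ` Pair a ` {z. (x, z) \<in> I a \<and> (z, y) \<in> I a}"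
    proof clarify
      fix z assume z: "(j, z) \<in> J v"
      then have zJ: "z \<in> Field (J v)"
        by (rule FieldI2)
      then have "(v, z) \<in> F ` Field (lex_sum r I)"
        unfolding im FJ using vw by simp
      then obtain b c where bc: "b \<in> Field r" "c \<in> Field (I b)" "F (b, c) = (v, z)"
        unfolding FI by auto
      have 1: "((a, x), (b, c)) \<in> lex_sum r I"
        using mF[of "(a, x)" "(b, c)"] a fld bc vj vw z zJ by (simp add: FI lex_sum_iff)
      have 2: "((b, c), (a, y)) \<in> lex_sum r I"
        using mF[of "(b, c)" "(a, y)"] a fld bc wk vw z zJ by (simp add: FI lex_sum_iff)
      have "b = a"
        using 1 2 Linear_orderD(3)[OF r] by (auto simp: lex_sum_iff)
      then show "(v, z) \<in> F ` Pair a ` {z. (x, z) \<in> I a \<and> (z, y) \<in> I a}"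
        using 1 2 bc by (force simp: lex_sum_iff)
    qed
    moreover have "finite (F ` Pair a ` {z. (x, z) \<in> I a \<and> (z, y) \<in> I a})"
      using fin[OF a] by auto
    ultimately have "finite (Pair v ` {z. (j, z) \<in> J v})"
      by (rule finite_subset)
    then have "finite {z. (j, z) \<in> J v}"
      by (rule finite_imageD) (auto simp: inj_on_def)
    then show False
      using inf vw by blast
  qed
  show ?thesis
    unfolding fibre_preserving_def FI
  proof (intro allI impI)
    fix a x y
    assume "(a, x) \<in> (SIGMA a:Field r. Field (I a))" "(a, y) \<in> (SIGMA a:Field r. Field (I a))"
    then have a: "a \<in> Field r" and "x \<in> Field (I a)" "y \<in> Field (I a)"
      by auto
    then have "(x, y) \<in> I a \<or> (y, x) \<in> I a"
      by (intro Linear_orderD(4)[OF I])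
    then show "fst (F (a, x)) = fst (F (a, y))"
      using main[OF a, of x y] main[OF a, of y x] by auto
  qed
qed

section \<open>Sums of copies of the naturals along a well-order\<close>

text \<open>\<open>int_from True\<close> has type \<open>\<omega>\<^sup>* + \<omega>\<close> and
  \<open>int_from False\<close> has type \<open>\<omega>\<close>. Both live on \<open>int\<close>,
  so a single family can put the former over the least index and the latter over all others.\<close>

definition int_from :: "bool \<Rightarrow> int rel" where
  "int_from P = {(m, n). m \<le> n \<and> (P \<or> 0 \<le> m)}"

lemma Field_int_from: "Field (int_from P) = {n. P \<or> 0 \<le> n}"
  by (auto simp: int_from_def Field_def)

lemma Linear_order_int_from: "Linear_order (int_from P)"
  unfolding order_on_defs Field_int_from
  by (auto simp: int_from_def refl_on_def trans_def antisym_def total_on_def)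

text \<open>
  This is \<open>\<omega>\<^sup>*\<close> followed by one copy of \<open>\<omega>\<close> for each element of \<open>W\<close> up to and including \<open>c\<close>.
  Points in the same copy of \<open>\<omega>\<close> are those at finite distance, hence \<open>c\<close> can be recovered.
\<close>

definition block :: "'s rel \<Rightarrow> 's \<Rightarrow> ('s \<times> int) rel" where
  "block W c = lex_sum (Restr W (under W c)) (\<lambda>d. int_from (\<forall>e. (d, e) \<in> W))"

lemma Field_Restr_under:
  assumes "Well_order W"
  shows "Field (Restr W (under W c)) = under W c"
proof (rule Field_Restr_ofilter[OF assms])
  show "wo_rel.ofilter W (under W c)"
    using assms by (simp add: wo_rel.under_ofilter wo_rel_def)
qed

lemma Field_block:
  assumes "Well_order W"
  shows "Field (block W c) = Sigma (under W c) (\<lambda>d. {n. (\<forall>e. (d, e) \<in> W) \<or> 0 \<le> n})"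
  unfolding block_def Field_int_from[symmetric]
  by (simp only: Field_lex_sum Linear_order_int_from Field_Restr_under[OF assms])

lemma Linear_order_block:
  assumes "Well_order W"
  shows "Linear_order (block W c)"
  unfolding block_def
  using Well_order_Restr[OF assms]
  by (intro Linear_order_lex_sum Linear_order_int_from) (simp add: well_order_on_def)

lemma Well_order_least:
  assumes "Well_order W" "D \<subseteq> Field W" "D \<noteq> {}"
  obtains d where "d \<in> D" "\<And>e. e \<in> D \<Longrightarrow> (d, e) \<in> W"
proof -
  have "Linear_order W"
    using assms(1) by (simp add: well_order_on_def)
  then have "\<exists>d\<in>D. \<forall>e\<in>D. (d, e) \<in> W"
    using assms Linear_order_Well_order_iff[of W] by simp
  then show ?thesis
    using that by auto
qed

text \<open>There is no least element because the fibre over the least index is a copy of the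
  integers. A minimum of a bounded set is found lexicographically: first the least index that
  occurs, then the least integer over it.\<close>

lemma bottomless_wo_block:
  assumes W: "Well_order W" "Field W = UNIV"
  shows "bottomless_wo (block W c)"
  unfolding bottomless_wo_def
proof (intro conjI ballI allI impI)
  note FB = Field_block[OF W(1)]
  have W_lin: "Linear_order W"
    using W(1) by (simp add: well_order_on_def)
  have FR: "Field (Restr W (under W c)) = under W c"
    by (rule Field_Restr_under[OF W(1)])
  have block_iff: "((d, m), (e, n)) \<in> block W c \<longleftrightarrow>
      (d, m) \<in> Field (block W c) \<and> (e, n) \<in> Field (block W c) \<and>
      ((d, e) \<in> W \<and> d \<noteq> e \<or> d = e \<and> m \<le> n)" for d m e n
    unfolding FB unfolding block_def lex_sum_iff FR Field_int_from by (auto simp: int_from_def)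
  obtain bot where bot: "\<And>e. (bot, e) \<in> W"
    using Well_order_least[OF W(1), of UNIV] W(2) by auto
  have bot_c: "bot \<in> under W c"
    using bot by (simp add: under_def)
  show "Linear_order (block W c)"
    by (rule Linear_order_block[OF W(1)])
  show "Field (block W c) \<noteq> {}"
    using bot_c bot unfolding FB by blast
  show "\<exists>y. (y, x) \<in> block W c \<and> y \<noteq> x" if "x \<in> Field (block W c)" for x
  proof -
    obtain d n where x: "x = (d, n)"
      by fastforce
    \<comment> \<open>One witness serves both cases: if \<open>d\<close> is \<open>bot\<close> it
      has a smaller integer, otherwise a smaller index.\<close>
    have "((bot, n - 1), (d, n)) \<in> block W c"
      using that bot bot_c unfolding x block_iff by (auto simp: FB)
    then show ?thesis
      unfolding x by (intro exI[of _ "(bot, n - 1)"]) simp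
  qed
  show "\<exists>m\<in>R. \<forall>y\<in>R. (m, y) \<in> block W c"
    if R: "R \<subseteq> Field (block W c)" "R \<noteq> {}" and b: "\<forall>y\<in>R. (b, y) \<in> block W c" for R b
  proof -
    obtain d where d: "d \<in> fst ` R" "\<And>e. e \<in> fst ` R \<Longrightarrow> (d, e) \<in> W"
      using Well_order_least[OF W(1), of "fst ` R"] W(2) R(2) by auto
    define N where "N = {n. (d, n) \<in> R}"
    obtain n0 where n0: "n0 \<in> N"
      using d(1) by (auto simp: N_def)
    \<comment> \<open>Negative integers occur only over the least index. There the given bound
      \<open>b\<close> must have the same index, so its integer is a bound; over any other index
      \<open>0\<close> is one.\<close>
    have "\<exists>l. \<forall>n\<in>N. l \<le> n"
    proof (cases "\<forall>e. (d, e) \<in> W")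
      case True
      obtain b1 b2 where b12: "b = (b1, b2)"
        by fastforce
      have "b2 \<le> n" if "n \<in> N" for n
      proof -
        have "((b1, b2), (d, n)) \<in> block W c"
          using that b by (simp add: N_def b12)
        then show ?thesis
          using True Linear_orderD(3)[OF W_lin, of b1 d] unfolding block_iff by blast
      qed
      then show ?thesis
        by auto
    next
      case False
      then have "\<forall>n\<in>N. 0 \<le> n"
        using R(1) by (auto simp: N_def FB)
      then show ?thesis
        by auto
    qed
    then obtain l where l: "\<And>n. n \<in> N \<Longrightarrow> l \<le> n"
      by auto
    \<comment> \<open>Shifting by the bound \<open>l\<close> turns the least integer of
      \<open>N\<close> into a least natural number.\<close>
    define k where "k = (LEAST k. l + int k \<in> N)"
    have "l + int (nat (n0 - l)) \<in> N"
      using n0 l by simp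
    then have kN: "l + int k \<in> N"
      unfolding k_def by (rule LeastI)
    have kle: "l + int k \<le> n" if "n \<in> N" for n
    proof -
      have "l + int (nat (n - l)) \<in> N"
        using that l by simp
      then have "k \<le> nat (n - l)"
        unfolding k_def by (rule Least_le)
      then show ?thesis
        using l[OF that] by simp
    qed
    have "((d, l + int k), y) \<in> block W c" if "y \<in> R" for y
    proof -
      obtain e n where y: "y = (e, n)"
        by fastforce
      have "(d, e) \<in> W"
        using d(2) that y by force
      then show ?thesis
        using that kN kle[of n] R(1) unfolding y block_iff by (auto simp: N_def)
    qed
    moreover have "(d, l + int k) \<in> R"
      using kN by (simp add: N_def)
    ultimately show ?thesis
      by blast
  qed
qed

text \<open>An isomorphism respects the copies of the integers and the naturals, so it induces one
  between the initial segments of \<open>W\<close> up to \<open>c\<close> and up to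
  \<open>d\<close>. Isomorphic initial segments of a well-order coincide.\<close>

lemma block_inj:
  includes cardinal_syntax
  assumes W: "Well_order W" "Field W = UNIV" and iso: "block W c \<cong>\<^sub>o block W d"
  shows "c = d"
proof -
  have lin: "Linear_order (Restr W (under W c))" for c
    using Well_order_Restr[OF W(1)] by (simp add: well_order_on_def)
  have fin: "finite {z. (x, z) \<in> int_from P \<and> (z, y) \<in> int_from P}" for x y P
    by (rule finite_subset[of _ "{x..y}"]) (auto simp: int_from_def)
  have inf: "infinite {z. (x, z) \<in> int_from P}" if "x \<in> Field (int_from P)" for x P
  proof -
    have "{z. (x, z) \<in> int_from P} = {x..}"
      using that unfolding Field_int_from by (auto simp: int_from_def)
    then show ?thesis
      using infinite_Ici[of x] by simp
  qed
  obtain F where F: "iso (block W c) (block W d) F"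
    using iso by (auto simp: order_isomorphic_def)
  have ne: "Field (int_from P) \<noteq> {}" for P
    by (auto simp: Field_int_from intro: exI[of _ 0])
  \<comment> \<open>In every fibre bounded intervals are finite and final segments are infinite, so
    the isomorphism and its inverse both respect the fibres.\<close>
  have "\<exists>g. iso (Restr W (under W c)) (Restr W (under W d)) g \<and>
      (\<forall>a\<in>Field (Restr W (under W c)).
        int_from (\<forall>e. (a, e) \<in> W) \<cong>\<^sub>o int_from (\<forall>e. (g a, e) \<in> W))"
    using F iso_inv_into[OF F] unfolding block_def
    by (intro fibre_preserving_iso_induces_iso locally_finite_fibre_preserving)
      (simp_all only: lin Linear_order_int_from ne fin inf not_False_eq_True)
  then obtain g where "iso (Restr W (under W c)) (Restr W (under W d)) g"
    by auto
  then have eq: "Restr W (under W c) =o Restr W (under W d)"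
    using Well_order_Restr[OF W(1)] by (auto simp: ordIso_def)
  have of: "wo_rel.ofilter W (under W c)" for c
    using W(1) by (simp add: wo_rel.under_ofilter wo_rel_def)
  \<comment> \<open>A proper inclusion of initial segments would make one of the well-orders
    strictly shorter than the other.\<close>
  have "\<not> under W c \<subset> under W d" "\<not> under W d \<subset> under W c"
    using ofilter_subset_ordLess[OF W(1) of of] eq not_ordLess_ordIso ordIso_symmetric by blast+
  moreover have W_lin: "Linear_order W"
    using W(1) by (simp add: well_order_on_def)
  then have "under W c \<subseteq> under W d \<or> under W d \<subseteq> under W c"
    using Linear_orderD(2)[OF W_lin] Linear_orderD(4)[OF W_lin, of c d] W(2)
    unfolding under_def by blast
  ultimately have "under W c = under W d"
    by auto
  moreover have "c \<in> under W c" "d \<in> under W d"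
    using Linear_orderD(1)[OF W_lin] W(2) by (auto simp: under_def)
  ultimately show ?thesis
    using Linear_orderD(3)[OF W_lin] by (auto simp: under_def)
qed

section \<open>Transport to sets over the index type\<close>

text \<open>Over an infinite type, pairing with the countable type \<open>int\<close> does not raise
  the cardinality, and singletons lead from \<open>'s\<close> into \<open>'s set\<close>. This moves
  the blocks to the carrier prescribed for the fibres of \<open>X\<close>.\<close>

lemma ex_inj_Times_int_set:
  includes cardinal_syntax
  assumes "infinite (UNIV :: 's set)"
  shows "\<exists>e :: 's \<times> int \<Rightarrow> 's set. inj e"
proof -
  have "|UNIV :: int set| \<le>o |UNIV :: nat set|"
    by (rule card_of_ordLeqI[of int_encode]) (auto intro: inj_int_encode)
  also have "|UNIV :: nat set| \<le>o |UNIV :: 's set|"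
    using assms infinite_iff_card_of_nat by blast
  finally have "|(UNIV :: 's set) \<times> (UNIV :: int set)| =o |UNIV :: 's set|"
    using assms card_of_Times_infinite by blast
  then have "|(UNIV :: 's set) \<times> (UNIV :: int set)| \<le>o |UNIV :: 's set|"
    by (rule ordIso_imp_ordLeq)
  then obtain f :: "'s \<times> int \<Rightarrow> 's" where "inj f"
    using card_of_ordLeq[of "(UNIV :: 's set) \<times> (UNIV :: int set)" "UNIV :: 's set"] by auto
  then have "inj (\<lambda>x. {f x})"
    by (auto simp: inj_def)
  then show ?thesis
    by blast
qed

text \<open>A well-ordering of the whole type yields one block for each of its elements; transport
  along an injection keeps them pairwise non-isomorphic.\<close>

lemma ex_bottomless_wo_family:
  assumes "infinite (UNIV :: 's set)"
  shows "\<exists>I :: 's \<Rightarrow> 's set rel. (\<forall>c. bottomless_wo (I c)) \<and> (\<forall>c d. I c \<cong>\<^sub>o I d \<longrightarrow> c = d)"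
proof -
  obtain W :: "'s rel" where W: "Well_order W" "Field W = UNIV"
    using well_ordering[where 'a = 's] by auto
  obtain e :: "'s \<times> int \<Rightarrow> 's set" where e: "inj e"
    using ex_inj_Times_int_set[OF assms] by auto
  define I where "I c = dir_image (block W c) e" for c
  have e_on: "inj_on e S" for S
    using e by (rule inj_on_subset) simp
  have iso: "iso (block W c) (I c) e" for c
    unfolding I_def by (intro iso_dir_image e_on)
  have "bottomless_wo (I c)" for c
    using iso
  proof (rule bottomless_wo_iso)
    show "Linear_order (I c)"
      unfolding I_def by (intro Linear_order_dir_image Linear_order_block W e_on)
  qed (intro bottomless_wo_block W)
  moreover have "c = d" if "I c \<cong>\<^sub>o I d" for c d
  proof (rule block_inj[OF W])
    have "block W c \<cong>\<^sub>o I c" "block W d \<cong>\<^sub>o I d"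
      using iso by (auto simp: order_isomorphic_def)
    then show "block W c \<cong>\<^sub>o block W d"
      using that order_isomorphic_sym order_isomorphic_trans by metis
  qed
  ultimately show ?thesis
    by blast
qed

section \<open>Sequences\<close>

text \<open>Trading the prefixes for numbers of dropped letters reduces composition of the relation
  to arithmetic modulo \<open>2\<close>.\<close>

lemma sim2_iff_sdrop:
  "sim2 S u v \<longleftrightarrow> u \<in> streams S \<and> v \<in> streams S \<and>
     (\<exists>m n. m mod 2 = n mod 2 \<and> sdrop m u = sdrop n v)"
proof
  assume "sim2 S u v"
  then obtain p q w where *: "p \<in> lists S" "q \<in> lists S" "w \<in> streams S"
    "length p mod 2 = length q mod 2" "u = p @- w" "v = q @- w"
    by (auto simp: sim2_def)
  then have "sdrop (length p) u = sdrop (length q) v"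
    by (simp add: sdrop_shift)
  then show "u \<in> streams S \<and> v \<in> streams S \<and> (\<exists>m n. m mod 2 = n mod 2 \<and> sdrop m u = sdrop n v)"
    using * by (auto intro: shift_streams)
next
  assume "u \<in> streams S \<and> v \<in> streams S \<and> (\<exists>m n. m mod 2 = n mod 2 \<and> sdrop m u = sdrop n v)"
  then obtain m n where *: "u \<in> streams S" "v \<in> streams S" "m mod 2 = n mod 2"
    "sdrop m u = sdrop n v"
    by auto
  have "stake m u \<in> lists S" "stake n v \<in> lists S" "sdrop n v \<in> streams S"
    using * by (auto simp: streams_iff_snth sdrop_snth in_set_conv_nth)
  then show "sim2 S u v"
    unfolding sim2_def using * stake_sdrop[of m u] stake_sdrop[of n v]
    by (intro bexI[of _ "stake m u"] bexI[of _ "stake n v"] bexI[of _ "sdrop n v"]) auto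
qed

lemma sim2_refl: "u \<in> streams S \<Longrightarrow> sim2 S u u"
  unfolding sim2_iff_sdrop by blast

lemma sim2_sym: "sim2 S u v \<Longrightarrow> sim2 S v u"
  unfolding sim2_iff_sdrop by metis

lemma sim2_trans:
  assumes "sim2 S u v" "sim2 S v w"
  shows "sim2 S u w"
proof -
  obtain k l m n where *: "k mod 2 = l mod 2" "sdrop k u = sdrop l v"
    "m mod 2 = n mod 2" "sdrop m v = sdrop n w"
    using assms by (auto simp: sim2_iff_sdrop)
  \<comment> \<open>Dropping further brings both tails of \<open>v\<close> to the common position
    \<open>l + m\<close>; the total numbers of dropped letters keep equal parity.\<close>
  have "sdrop (k + m) u = sdrop (l + m) v"
    using *(2) by (metis sdrop_add)
  also have "\<dots> = sdrop (n + l) w"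
    using *(4) by (metis sdrop_add add.commute)
  finally have "sdrop (k + m) u = sdrop (n + l) w" .
  moreover have "(k + m) mod 2 = (n + l) mod 2"
    using mod_add_cong[OF *(1,3)] by (simp add: add.commute)
  ultimately show ?thesis
    using assms unfolding sim2_iff_sdrop by metis
qed

text \<open>Two letters are dropped on one side and none on the other. This is why the fibres of
  \<open>X\<close> survive two prepended letters.\<close>

lemma sim2_stl_stl:
  assumes "u \<in> streams S"
  shows "sim2 S u (stl (stl u))"
proof -
  have "sdrop 2 u = sdrop 0 (stl (stl u))"
    by (simp add: numeral_2_eq_2)
  then show ?thesis
    using assms unfolding sim2_iff_sdrop by (metis mod_self mod_0 streams_stl)
qed

section \<open>Splitting off the first letter of a sequence\<close>

text \<open>In relational form, \<open>A\<^sup>\<omega>\<close> is isomorphic to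
  \<open>A A\<^sup>\<omega>\<close>: a first difference at \<open>0\<close> concerns the heads, one
  at \<open>Suc k\<close> is a first difference of the tails at \<open>k\<close>.\<close>

lemma omega_power_unfold:
  "(u, v) \<in> omega_power A \<longleftrightarrow>
     u \<in> streams (Field A) \<and> v \<in> streams (Field A) \<and>
     ((shd u, shd v) \<in> A \<and> shd u \<noteq> shd v \<or> shd u = shd v \<and> (stl u, stl v) \<in> omega_power A)"
  (is "?L \<longleftrightarrow> ?R")
proof
  assume L: ?L
  then have S: "u \<in> streams (Field A)" "v \<in> streams (Field A)"
    by (auto simp: omega_power_def)
  then have T: "stl u \<in> streams (Field A)" "stl v \<in> streams (Field A)"
    by (auto intro: streams_stl)
  show ?R
  proof (cases "u = v")
    case True
    then show ?thesis
      using S T by (simp add: omega_power_def)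
  next
    case False
    then obtain n where n: "\<forall>m<n. u !! m = v !! m" "u !! n \<noteq> v !! n" "(u !! n, v !! n) \<in> A"
      using L by (auto simp: omega_power_def)
    show ?thesis
    proof (cases n)
      case 0
      then show ?thesis
        using n S by simp
    next
      case (Suc k)
      then have "shd u = shd v" "\<forall>m<k. stl u !! m = stl v !! m"
        "stl u !! k \<noteq> stl v !! k" "(stl u !! k, stl v !! k) \<in> A"
        using n by (auto dest: spec[of _ 0] spec[of _ "Suc _"])
      then show ?thesis
        using S T unfolding omega_power_def by blast
    qed
  qed
next
  assume R: ?R
  show ?L
  proof (cases "shd u = shd v")
    case False
    then have "\<exists>n. (\<forall>m<n. u !! m = v !! m) \<and> u !! n \<noteq> v !! n \<and> (u !! n, v !! n) \<in> A"
      using R by (intro exI[of _ 0]) auto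
    then show ?thesis
      using R by (simp add: omega_power_def)
  next
    case True
    show ?thesis
    proof (cases "stl u = stl v")
      case eq: True
      then have "u = v"
        using True by (simp add: stream.expand)
      then show ?thesis
        using R by (simp add: omega_power_def)
    next
      case False
      then obtain n where n: "\<forall>m<n. stl u !! m = stl v !! m" "stl u !! n \<noteq> stl v !! n"
        "(stl u !! n, stl v !! n) \<in> A"
        using R True by (auto simp: omega_power_def)
      have "\<forall>m<Suc n. u !! m = v !! m"
        using n(1) True by (auto simp: less_Suc_eq_0_disj)
      moreover have "u !! Suc n \<noteq> v !! Suc n" "(u !! Suc n, v !! Suc n) \<in> A"
        using n by simp_all
      ultimately show ?thesis
        using R unfolding omega_power_def by blast
    qed
  qed
qed

text \<open>In the product the letter in front does not affect the fibre, so once it is glued to the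
  sequence the fibre depends on the tail. As \<open>J\<close> is any family of linear orders, the
  step can be repeated with \<open>J (stl u)\<close> in place of \<open>J u\<close>.\<close>

lemma iso_lex_sum_omega_power_stl:
  assumes A: "Linear_order A" and J: "\<And>u. Linear_order (J u)"
  shows "iso (lex_sum (omega_power A) (\<lambda>u. J (stl u))) (A \<otimes>\<^sub>l lex_sum (omega_power A) J)
    (\<lambda>(u, x). (shd u, stl u, x))"
proof -
  have L: "Linear_order (lex_sum (omega_power A) J)"
    using A J by (intro Linear_order_lex_sum Linear_order_omega_power)
  have F: "Field (lex_sum (omega_power A) K) = Sigma (streams (Field A)) (\<lambda>u. Field (K u))"
    if "\<And>u. Linear_order (K u)" for K :: "'a stream \<Rightarrow> 'b rel"
    using that by (simp only: Field_lex_sum Field_omega_power)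
  have FP: "Field (A \<otimes>\<^sub>l lex_sum (omega_power A) J)
      = Field A \<times> Sigma (streams (Field A)) (\<lambda>u. Field (J u))"
    unfolding Field_lex_product[OF A L] F[OF J] ..
  have FS: "Field (lex_sum (omega_power A) (\<lambda>u. J (stl u)))
      = Sigma (streams (Field A)) (\<lambda>u. Field (J (stl u)))"
    using J by (intro F)
  show ?thesis
    unfolding iso_iff2
  proof (intro conjI ballI)
    show "bij_betw (\<lambda>(u, x). (shd u, stl u, x)) (Field (lex_sum (omega_power A) (\<lambda>u. J (stl u))))
        (Field (A \<otimes>\<^sub>l lex_sum (omega_power A) J))"
      unfolding FS FP
      by (rule bij_betwI[where g = "\<lambda>(a, u, x). (a ## u, x)"])
        (auto intro: streams_shd streams_stl streams_Stream)
    fix s t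
    assume s: "s \<in> Field (lex_sum (omega_power A) (\<lambda>u. J (stl u)))"
      and t: "t \<in> Field (lex_sum (omega_power A) (\<lambda>u. J (stl u)))"
    obtain u x v y where uv: "s = (u, x)" "t = (v, y)"
      by fastforce
    have *: "u \<in> streams (Field A)" "v \<in> streams (Field A)"
      "x \<in> Field (J (stl u))" "y \<in> Field (J (stl v))"
      using s t unfolding uv FS by auto
    then have **: "stl u \<in> streams (Field A)" "stl v \<in> streams (Field A)"
      "shd u \<in> Field A" "shd v \<in> Field A"
      by (auto intro: streams_stl streams_shd)
    have "u = v \<longleftrightarrow> shd u = shd v \<and> stl u = stl v"
      by (auto intro: stream.expand)
    then show "(s, t) \<in> lex_sum (omega_power A) (\<lambda>u. J (stl u)) \<longleftrightarrow>
        ((\<lambda>(u, x). (shd u, stl u, x)) s, (\<lambda>(u, x). (shd u, stl u, x)) t)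
          \<in> A \<otimes>\<^sub>l lex_sum (omega_power A) J"
      unfolding uv using * **
      by (auto simp: lex_product_iff lex_sum_iff Field_omega_power F[OF J] omega_power_unfold[of u v])
  qed
qed

lemma infinite_streams:
  assumes "(a :: 'a) \<noteq> b"
  shows "infinite (UNIV :: 'a stream set)"
proof -
  define s where "s n = replicate n a @- sconst b" for n
  have s: "s n !! m = (if m < n then a else b)" for n m
    by (simp add: s_def shift_snth)
  \<comment> \<open>Position \<open>m\<close> of \<open>s m\<close> holds \<open>b\<close>, so
    \<open>s n\<close> cannot hold \<open>a\<close> there.\<close>
  have "m \<ge> n" if "s n = s m" for n m
    using that s[of n m] s[of m m] assms by (metis less_irrefl not_less)
  then have "inj s"
    by (intro injI) (metis order_antisym)
  then show ?thesis
    using infinite_iff_countable_subset by blast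
qed

text \<open>Over at most one letter there is at most one sequence, and prepending fixes it. Ruling
  this case out provides two letters, hence infinitely many sequences.\<close>

lemma parity_reversing_automorphism_id:
  assumes "\<And>a b. a \<in> Field A \<Longrightarrow> b \<in> Field A \<Longrightarrow> a = b"
  shows "parity_reversing_automorphism A id"
proof -
  have "a ## u = u" if "u \<in> streams (Field A)" "a \<in> Field A" for a u
  proof -
    have "\<And>n. u !! n = a"
      using assms that by (auto simp: streams_iff_snth)
    then have "(a ## u) !! n = u !! n" for n
      by (cases n) (metis snth.simps stream.sel)+
    then show ?thesis
      by (metis ext smap_alt stream.map_id0 id_apply)
  qed
  then show ?thesis
    by (auto simp: parity_reversing_automorphism_def iso_iff2 intro: sim2_refl)
qed

section \<open>The order \<open>X\<close> and its products with \<open>A\<close>\<close>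

theorem theorem6p2:
  fixes A :: "'a rel"
  assumes "Linear_order A"
    and "\<not> (\<exists>f. parity_reversing_automorphism A f)"
  shows "\<exists>X :: ('a stream \<times> 'a stream set) rel.
           Linear_order X \<and> (A \<otimes>\<^sub>l A) \<otimes>\<^sub>l X \<cong>\<^sub>o X \<and> \<not> (A \<otimes>\<^sub>l X \<cong>\<^sub>o X)"
proof -
  note A = assms(1)
  have "infinite (UNIV :: 'a stream set)"
    using parity_reversing_automorphism_id assms(2) infinite_streams by metis
  then obtain I :: "'a stream \<Rightarrow> 'a stream set rel" where
    I: "\<And>c. bottomless_wo (I c)" and I_inj: "\<And>c d. I c \<cong>\<^sub>o I d \<Longrightarrow> c = d"
    using ex_bottomless_wo_family by blast
  \<comment> \<open>Representatives stand for the classes, so that sequences themselves serve as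
    indices of the family \<open>I\<close>.\<close>
  define c where "c u = (SOME v. sim2 (Field A) u v)" for u
  have c_eq: "c u = c v" if "sim2 (Field A) u v" for u v
  proof -
    have "sim2 (Field A) u = sim2 (Field A) v"
      using that sim2_sym sim2_trans by blast
    then show ?thesis
      by (simp add: c_def)
  qed
  have c_sim: "sim2 (Field A) u (c u)" if "u \<in> streams (Field A)" for u
    unfolding c_def using sim2_refl[OF that] by (rule someI)
  define P where "P = omega_power A"
  have P: "Linear_order P" "Field P = streams (Field A)"
    unfolding P_def by (rule Linear_order_omega_power[OF A], rule Field_omega_power)
  define J where "J u = I (c u)" for u
  have J: "bottomless_wo (J u)" "Linear_order (J u)" for u
    using I bottomless_woD(1) by (auto simp: J_def)
  define X where "X = lex_sum P J"
  \<comment> \<open>\<open>Y\<close> is a copy of \<open>A \<otimes>\<^sub>l X\<close> with index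
    order \<open>P\<close>, which makes it comparable with \<open>X\<close> fibre by fibre.\<close>
  define Y where "Y = lex_sum P (\<lambda>u. J (stl u))"
  have X: "Linear_order X" and Y: "Linear_order Y"
    unfolding X_def Y_def by (intro Linear_order_lex_sum P J)+
  have YX: "iso Y (A \<otimes>\<^sub>l X) (\<lambda>(u, x). (shd u, stl u, x))"
    unfolding X_def Y_def P_def by (intro iso_lex_sum_omega_power_stl A J)
  \<comment> \<open>Only fibres over sequences in \<open>Field P\<close> enter the sum, and there
    dropping two letters keeps the class.\<close>
  have "X = lex_sum P (\<lambda>u. J (stl (stl u)))"
  proof -
    have "J (stl (stl u)) = J u" if "u \<in> Field P" for u
      using c_eq[OF sim2_stl_stl] that P(2) by (simp add: J_def)
    then show ?thesis
      unfolding X_def by (auto simp: lex_sum_def)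
  qed
  moreover have "iso (lex_sum P (\<lambda>u. J (stl (stl u)))) (A \<otimes>\<^sub>l Y) (\<lambda>(u, x). (shd u, stl u, x))"
    unfolding Y_def P_def by (intro iso_lex_sum_omega_power_stl A J)
  ultimately have XY: "A \<otimes>\<^sub>l Y \<cong>\<^sub>o X"
    by (intro order_isomorphic_sym[of X]) (auto simp: order_isomorphic_def)
  have "(A \<otimes>\<^sub>l A) \<otimes>\<^sub>l X \<cong>\<^sub>o A \<otimes>\<^sub>l (A \<otimes>\<^sub>l X)"
    by (intro order_isomorphic_lex_product_assoc A X)
  also have "A \<otimes>\<^sub>l (A \<otimes>\<^sub>l X) \<cong>\<^sub>o A \<otimes>\<^sub>l Y"
    using YX by (intro order_isomorphic_lex_product_right order_isomorphic_sym[of Y]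
        Linear_order_lex_product A X Y) (auto simp: order_isomorphic_def)
  also note XY
  finally have "(A \<otimes>\<^sub>l A) \<otimes>\<^sub>l X \<cong>\<^sub>o X" .
  moreover have "\<not> A \<otimes>\<^sub>l X \<cong>\<^sub>o X"
  proof
    assume "A \<otimes>\<^sub>l X \<cong>\<^sub>o X"
    then obtain F where "iso Y X F"
      using YX by (auto simp: order_isomorphic_def dest: iso_compose)
    \<comment> \<open>All fibres of \<open>Y\<close> and \<open>X\<close> satisfy
      \<open>bottomless_wo\<close>, so \<open>F\<close> carries fibres onto fibres; \<open>g\<close>
      records where they go.\<close>
    then obtain g where g: "iso P P g" and gJ: "\<And>u. u \<in> Field P \<Longrightarrow> J (stl u) \<cong>\<^sub>o J (g u)"
      using bottomless_wo_sum_iso[of P P "\<lambda>u. J (stl u)" J F] P(1) J(1) unfolding X_def Y_def by auto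
    have "sim2 (Field A) (g u) (a ## u)" if u: "u \<in> streams (Field A)" and a: "a \<in> Field A" for u a
    proof -
      have gu: "g u \<in> streams (Field A)"
        using g u P(2) by (auto simp: iso_iff2 bij_betw_def)
      have "sim2 (Field A) (stl u) (c (stl u))"
        using u by (intro c_sim streams_stl)
      \<comment> \<open>Distinct members of \<open>I\<close> are not isomorphic, so isomorphic
        fibres come from the same class.\<close>
      moreover have "c (stl u) = c (g u)"
        using gJ[of u] I_inj u P(2) by (simp add: J_def)
      ultimately have "sim2 (Field A) (g u) (stl u)"
        using c_sim[OF gu] sim2_sym sim2_trans by metis
      \<comment> \<open>Removing two letters from \<open>a ## u\<close> leaves \<open>stl u\<close>,
        whatever \<open>a\<close> is.\<close>
      moreover have "sim2 (Field A) (stl u) (a ## u)"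
        using sim2_stl_stl[of "a ## u" "Field A"] u a
      by (intro sim2_sym[of _ "a ## u"]) (simp add: streams_Stream)
      ultimately show ?thesis
        by (rule sim2_trans)
    qed
    then show False
      using assms(2) g unfolding parity_reversing_automorphism_def P_def by blast
  qed
  ultimately show ?thesis
    using X by blast
qed

end
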